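(* For every integer $n>0$, the following equality holds: $$\sum_{\nu=n+1}^\infty \int_\nu^\infty \biggl(\frac{n!}{t(t+1)\cdots(t+n)}\biggr)^{2} dt = \iint\limits_{[0,1]^2} \frac{\bigl(x(1-x)y(1-y)\bigr)^n}{(1-xy)(-\log xy)}\,dx\,dy.$$
   Context: Here $\log xy$ means $\log(xy)$. *)

theory Defs
  imports "HOL-Analysis.Analysis"
begin

definition series_integrand :: "nat \<Rightarrow> real \<Rightarrow> real" where
  "series_integrand n t = (fact n / (\<Prod>j=0..n. t + real j)) ^ 2"

text \<open>
  On the unit square, the totalized values of \<open>/\<close> and \<open>ln\<close> only matter where \<open>x * y\<close> is \<open>0\<close> or
  \<open>1\<close>, which is a null set.
\<close>

definition square_integrand :: "nat \<Rightarrow> real \<Rightarrow> real \<Rightarrow> real" where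
  "square_integrand n x y =
     (x * (1 - x) * y * (1 - y)) ^ n / ((1 - x * y) * (- ln (x * y)))"

end

theory Submission
  imports Defs "HOL-Real_Asymp.Real_Asymp"
begin

text \<open>
  The factor \<open>n! / (t (t + 1) \<cdots> (t + n))\<close> is the Beta integral of \<open>x\<^sup>t\<^sup>-\<^sup>1 (1 - x)\<^sup>n\<close> over \<open>[0, 1]\<close>.
  Write its square as a double integral, exchange the order of integration (all integrands are
  nonnegative), and use that the integral of \<open>(x y)\<^sup>t\<^sup>-\<^sup>1\<close> over \<open>t \<ge> \<nu>\<close> is
  \<open>(x y)\<^sup>\<nu>\<^sup>-\<^sup>1 / (- log (x y))\<close>; summing over \<open>\<nu>\<close> is then a geometric series.
\<close>

text \<open>The indicator is part of the kernel, so it is nonnegative on the whole line and order of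
  integration can be exchanged over \<open>lborel\<close> without restricting to sets.\<close>

definition beta_kernel :: "nat \<Rightarrow> real \<Rightarrow> real \<Rightarrow> real" where
  "beta_kernel n t x = indicator {0..1} x * (x powr (t - 1) * (1 - x) ^ n)"

lemma beta_kernel_nonneg: "beta_kernel n t x \<ge> 0"
  by (auto simp: beta_kernel_def indicator_def)

lemma beta_kernel_measurable [measurable]:
  assumes [measurable]: "f \<in> borel_measurable M" "g \<in> borel_measurable M"
  shows "(\<lambda>x. beta_kernel n (f x) (g x)) \<in> borel_measurable M"
  unfolding beta_kernel_def by measurable

lemma series_integrand_measurable [measurable]: "series_integrand n \<in> borel_measurable borel"
  unfolding series_integrand_def[abs_def] by measurable

lemma square_integrand_measurable [measurable]:
  assumes [measurable]: "f \<in> borel_measurable M" "g \<in> borel_measurable M"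
  shows "(\<lambda>x. square_integrand n (f x) (g x)) \<in> borel_measurable M"
  unfolding square_integrand_def by measurable

lemma series_integrand_nonneg: "series_integrand n t \<ge> 0"
  by (simp add: series_integrand_def)

lemma square_integrand_nonneg:
  assumes "x \<in> {0..1}" "y \<in> {0..1}"
  shows "square_integrand n x y \<ge> 0"
\<comment> \<open>On the axes \<open>ln 0\<close> is only a default value, so they are treated
  apart. At \<open>x = y = 1\<close> the denominator is 0, and the nonstrict sign used below covers
  it.\<close>
proof (cases "x * y = 0")
  case False
  then have "0 < x * y" using assms by (metis atLeastAtMost_iff less_le mult_nonneg_nonneg)
  moreover have "x * y \<le> 1" using assms by (simp add: mult_le_one)
  ultimately have "0 \<le> (1 - x * y) * (- ln (x * y))" by (intro mult_nonneg_nonneg) auto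
  moreover have "0 \<le> (x * (1 - x) * y * (1 - y)) ^ n" using assms by auto
  ultimately show ?thesis unfolding square_integrand_def by (rule divide_nonneg_nonneg[rotated])
qed (auto simp: square_integrand_def)

text \<open>The quotient \<open>Gamma (t + n + 1) / Gamma t\<close> in the Beta function is the
  rising factorial of \<open>t\<close> with \<open>n + 1\<close> factors.\<close>

lemma Beta_Suc_nat:
  assumes "t > (0::real)"
  shows "Beta t (real n + 1) = fact n / (\<Prod>j=0..n. t + real j)"
proof -
  have "t \<notin> \<int>\<^sub>\<le>\<^sub>0" using assms by (auto elim!: nonpos_Ints_cases)
  then have "pochhammer t (Suc n) = Gamma (t + real (Suc n)) / Gamma t"
    by (rule pochhammer_Gamma)
  moreover have "pochhammer t (Suc n) = (\<Prod>j=0..n. t + real j)"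
    by (simp add: pochhammer_prod atLeast0LessThan lessThan_Suc_atMost atLeast0AtMost)
  moreover have "Gamma (real n + 1) = fact n"
    by (simp add: Gamma_fact add.commute)
  ultimately show ?thesis
    by (simp add: Beta_def add_ac)
qed

lemma nn_integral_beta_kernel:
  assumes "t > 0" "n > 0"
  shows "(\<integral>\<^sup>+x. ennreal (beta_kernel n t x) \<partial>lborel) = ennreal (fact n / (\<Prod>j=0..n. t + real j))"
proof -
  have "((\<lambda>x. x powr (t - 1) * (1 - x) powr (real n + 1 - 1)) has_integral Beta t (real n + 1)) {0..1}"
    by (rule has_integral_Beta_real) (use assms in auto)
  \<comment> \<open>At \<open>x = 1\<close> the base is 0, where \<open>powr\<close> and the natural
    power agree because \<open>n > 0\<close>; \<open>0 powr 0\<close> is 0 but \<open>0 ^ 0\<close>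
    is 1.\<close>
  then have "((\<lambda>x. x powr (t - 1) * (1 - x) ^ n) has_integral Beta t (real n + 1)) {0..1}"
    by (rule has_integral_eq[rotated]) (use assms in \<open>auto simp: powr_realpow'\<close>)
  then show ?thesis
    using nn_integral_has_integral_lebesgue[of "{0..1}" "\<lambda>x. x powr (t - 1) * (1 - x) ^ n"] assms
    by (simp add: beta_kernel_def Beta_Suc_nat)
qed

text \<open>The antiderivative \<open>z powr (t - 1) / ln z\<close> tends to 0 at infinity since
  \<open>ln z < 0\<close>. This is where the logarithm in the square integrand comes from.\<close>

lemma nn_integral_powr_atLeast:
  fixes z a :: real
  assumes "0 < z" "z < 1"
  shows "(\<integral>\<^sup>+t. ennreal (z powr (t - 1)) * indicator {a..} t \<partial>lborel)
    = ennreal (z powr (a - 1) / (- ln z))"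
proof -
  have "ln z < 0" using assms by simp
  then have "((\<lambda>t. exp ((t - 1) * ln z) / ln z) \<longlongrightarrow> 0) at_top"
    by real_asymp
  then have lim: "((\<lambda>t. z powr (t - 1) / ln z) \<longlongrightarrow> 0) at_top"
    using assms by (simp add: powr_def)
  have "(\<integral>\<^sup>+t. ennreal (z powr (t - 1)) * indicator {a..} t \<partial>lborel)
      = ennreal (0 - z powr (a - 1) / ln z)"
    by (rule nn_integral_FTC_atLeast[OF _ _ _ lim])
      (use assms in \<open>auto intro!: derivative_eq_intros simp: field_simps\<close>)
  then show ?thesis by simp
qed

text \<open>A crude cubic decay in \<open>a\<close>: it makes each tail integral finite and, since
  reciprocal cubes are summable, later gives convergence of the series of tails.\<close>

lemma nn_integral_series_integrand_le:
  fixes a :: real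
  assumes "n > 0" "a \<ge> 1"
  shows "(\<integral>\<^sup>+t. ennreal (series_integrand n t) * indicator {a..} t \<partial>lborel)
    \<le> ennreal ((fact n)\<^sup>2 / (3 * a ^ 3))"
proof -
  have "series_integrand n t \<le> (fact n)\<^sup>2 / t ^ 4" if "t \<ge> a" for t
  proof -
    have t: "t \<ge> 1" using that assms by simp
    \<comment> \<open>As \<open>n > 0\<close>, the product has at least two factors, each at least
      \<open>t \<ge> 1\<close>. Squaring gives the exponent 4.\<close>
    have "t ^ 2 \<le> t ^ Suc n" by (rule power_increasing) (use t assms in auto)
    also have "\<dots> = (\<Prod>j=0..n. t)" by simp
    also have "\<dots> \<le> (\<Prod>j=0..n. t + real j)" by (rule prod_mono) (use t in auto)
    finally have "(t\<^sup>2)\<^sup>2 \<le> (\<Prod>j=0..n. t + real j)\<^sup>2" by (rule power_mono) simp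
    then show ?thesis using t
      by (auto simp: series_integrand_def power_divide intro!: divide_left_mono mult_pos_pos prod_pos)
  qed
  then have "(\<integral>\<^sup>+t. ennreal (series_integrand n t) * indicator {a..} t \<partial>lborel)
      \<le> (\<integral>\<^sup>+t. ennreal ((fact n)\<^sup>2 / t ^ 4) * indicator {a..} t \<partial>lborel)"
    by (intro nn_integral_mono) (auto simp: indicator_def)
  also have "\<dots> = ennreal (0 - (- ((fact n)\<^sup>2 / (3 * a ^ 3))))"
  proof (rule nn_integral_FTC_atLeast)
    show "((\<lambda>t::real. - ((fact n)\<^sup>2 / (3 * t ^ 3))) \<longlongrightarrow> 0) at_top" by real_asymp
    show "((\<lambda>t. - ((fact n)\<^sup>2 / (3 * t ^ 3))) has_real_derivative (fact n)\<^sup>2 / t ^ 4) (at t)"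
      if "a \<le> t" for t
      using that assms
      by (auto intro!: derivative_eq_intros simp: divide_simps power2_eq_square eval_nat_numeral)
  qed auto
  finally show ?thesis by simp
qed

text \<open>The product of the two kernels depends on \<open>t\<close> only through a power of
  \<open>z = x * y\<close>. The tail integrals are therefore geometric in \<open>k\<close> with
  ratio \<open>z\<close>, and the open square keeps \<open>z\<close> away from 0 and 1.\<close>

lemma square_integrand_expansion:
  assumes "0 < x" "x < 1" "0 < y" "y < 1"
  shows "ennreal (square_integrand n x y) = (\<Sum>k. \<integral>\<^sup>+t. ennreal (beta_kernel n t x)
    * ennreal (beta_kernel n t y) * indicator {real (n + 1 + k)..} t \<partial>lborel)"
proof -
  define z c where "z = x * y" and "c = ((1 - x) * (1 - y)) ^ n"
  have z: "0 < z" "z < 1" and c: "c \<ge> 0"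
    using assms mult_strict_mono[of x 1 y 1] by (auto simp: z_def c_def)
  have lnz: "ln z < 0" using z by simp
  have eq: "ennreal (beta_kernel n t x) * ennreal (beta_kernel n t y)
      = ennreal c * ennreal (z powr (t - 1))" for t
    using assms c by (simp add: beta_kernel_def z_def c_def powr_mult power_mult_distrib mult_ac
        flip: ennreal_mult)
  have "(\<integral>\<^sup>+t. ennreal (beta_kernel n t x) * ennreal (beta_kernel n t y)
        * indicator {real (n + 1 + k)..} t \<partial>lborel)
      = ennreal (c * z ^ n / (- ln z) * z ^ k)" for k
  proof -
    have "(\<integral>\<^sup>+t. ennreal (beta_kernel n t x) * ennreal (beta_kernel n t y)
        * indicator {real (n + 1 + k)..} t \<partial>lborel)
      = ennreal c * (\<integral>\<^sup>+t. ennreal (z powr (t - 1)) * indicator {real (n + 1 + k)..} t \<partial>lborel)"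
      unfolding eq mult.assoc by (rule nn_integral_cmult) measurable
    \<comment> \<open>The lower limit \<open>n + 1 + k\<close> enters lowered by one, so the series
      starts with exactly the factor \<open>z ^ n\<close> of the numerator.\<close>
    also have "\<dots> = ennreal (c * (z powr real (n + k) / (- ln z)))"
      using z c by (simp add: nn_integral_powr_atLeast divide_nonneg_neg
        flip: ennreal_mult)
    also have "z powr real (n + k) = z ^ n * z ^ k"
      using z by (simp add: powr_realpow power_add del: of_nat_add)
    finally show ?thesis by (simp add: mult_ac)
  qed
  moreover have "(\<Sum>k. ennreal (c * z ^ n / (- ln z) * z ^ k))
      = ennreal (c * z ^ n / (- ln z) * (1 / (1 - z)))"
  proof (rule suminf_ennreal_eq)
    show "0 \<le> c * z ^ n / (- ln z) * z ^ k" for k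
      using z c lnz by (intro mult_nonneg_nonneg divide_nonneg_nonneg) auto
    show "(\<lambda>k. c * z ^ n / (- ln z) * z ^ k) sums (c * z ^ n / (- ln z) * (1 / (1 - z)))"
      by (intro sums_mult geometric_sums) (use z in auto)
  qed
  moreover have "square_integrand n x y = c * z ^ n / (- ln z) * (1 / (1 - z))"
    by (simp add: square_integrand_def c_def z_def power_mult_distrib mult_ac)
  ultimately show ?thesis by simp
qed

text \<open>Working in \<open>ennreal\<close> permits every exchange of sums and integrals before
  any finiteness is known. The left integrand has the form of an unfolded set integral, ready for
  the final theorem.\<close>

lemma nn_integral_square_integrand:
  assumes "n > 0"
  shows "(\<integral>\<^sup>+p. ennreal (indicator ({0..1} \<times> {0..1}) p *\<^sub>R (case p of (x, y) \<Rightarrow> square_integrand n x y)) \<partial>lborel)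
    = (\<Sum>k. \<integral>\<^sup>+t. ennreal (series_integrand n t) * indicator {real (n + 1 + k)..} t \<partial>lborel)"
    (is "?L = _")
proof -
  let ?B = "beta_kernel n"
  let ?I = "\<lambda>k. indicator {real (n + 1 + k)..} :: real \<Rightarrow> ennreal"
  have AE01: "AE x in lborel. x \<noteq> 0 \<and> x \<noteq> (1::real)"
    using AE_lborel_singleton[of "0::real"] AE_lborel_singleton[of "1::real"] by eventually_elim auto
  \<comment> \<open>Outside the unit square one of the kernels vanishes, so both sides are 0. The
    excluded coordinates 0 and 1 form a null set.\<close>
  have expand: "ennreal (indicator ({0..1} \<times> {0..1}) (x, y) *\<^sub>R square_integrand n x y)
      = (\<Sum>k. \<integral>\<^sup>+t. ennreal (?B t x) * ennreal (?B t y) * ?I k t \<partial>lborel)"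
    if "x \<noteq> 0 \<and> x \<noteq> 1" "y \<noteq> 0 \<and> y \<noteq> 1" for x y
  proof (cases "x \<in> {0..1} \<and> y \<in> {0..1}")
    case True
    then show ?thesis using that square_integrand_expansion[of x y n] by auto
  next
    case False
    then show ?thesis by (auto simp: beta_kernel_def)
  qed
  have "?L = (\<integral>\<^sup>+x. \<integral>\<^sup>+y. ennreal (indicator ({0..1} \<times> {0..1}) (x, y) *\<^sub>R square_integrand n x y)
      \<partial>lborel \<partial>lborel)"
    unfolding lborel_prod[symmetric]
    by (subst lborel.nn_integral_fst[symmetric]) (auto simp: case_prod_unfold)
  also have "\<dots> = (\<integral>\<^sup>+x. \<integral>\<^sup>+y. (\<Sum>k. \<integral>\<^sup>+t. ennreal (?B t x) * ennreal (?B t y) * ?I k t \<partial>lborel)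
      \<partial>lborel \<partial>lborel)"
  proof (rule nn_integral_cong_AE)
    show "AE x in lborel. (\<integral>\<^sup>+y. ennreal (indicator ({0..1} \<times> {0..1}) (x, y) *\<^sub>R square_integrand n x y) \<partial>lborel)
      = (\<integral>\<^sup>+y. (\<Sum>k. \<integral>\<^sup>+t. ennreal (?B t x) * ennreal (?B t y) * ?I k t \<partial>lborel) \<partial>lborel)"
      using AE01
    proof eventually_elim
      case (elim x)
      from AE01 have "AE y in lborel. ennreal (indicator ({0..1} \<times> {0..1}) (x, y) *\<^sub>R square_integrand n x y)
        = (\<Sum>k. \<integral>\<^sup>+t. ennreal (?B t x) * ennreal (?B t y) * ?I k t \<partial>lborel)"
        by eventually_elim (rule expand[OF elim])
      then show ?case by (rule nn_integral_cong_AE)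
    qed
  qed
  also have "\<dots> = (\<Sum>k. \<integral>\<^sup>+x. \<integral>\<^sup>+y. \<integral>\<^sup>+t. ennreal (?B t x) * ennreal (?B t y) * ?I k t
      \<partial>lborel \<partial>lborel \<partial>lborel)"
    by (subst nn_integral_suminf, measurable)+
  also have "\<dots> = (\<Sum>k. \<integral>\<^sup>+t. ennreal (series_integrand n t) * ?I k t \<partial>lborel)"
  proof (rule suminf_cong)
    fix k
    \<comment> \<open>Two swaps bring \<open>t\<close> outermost: first past \<open>y\<close> with
      \<open>x\<close> fixed, then past \<open>x\<close>. The inner integrals then factor into two
      Beta integrals.\<close>
    have "(\<integral>\<^sup>+x. \<integral>\<^sup>+y. \<integral>\<^sup>+t. ennreal (?B t x) * ennreal (?B t y) * ?I k t \<partial>lborel \<partial>lborel \<partial>lborel)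
        = (\<integral>\<^sup>+x. \<integral>\<^sup>+t. \<integral>\<^sup>+y. ennreal (?B t x) * ennreal (?B t y) * ?I k t \<partial>lborel \<partial>lborel \<partial>lborel)"
      by (intro nn_integral_cong lborel_pair.Fubini') measurable
    also have "\<dots> = (\<integral>\<^sup>+t. \<integral>\<^sup>+x. \<integral>\<^sup>+y. ennreal (?B t x) * ennreal (?B t y) * ?I k t \<partial>lborel \<partial>lborel \<partial>lborel)"
      by (intro lborel_pair.Fubini') measurable
    also have "\<dots> = (\<integral>\<^sup>+t. (\<integral>\<^sup>+x. ennreal (?B t x) \<partial>lborel) * (\<integral>\<^sup>+y. ennreal (?B t y) \<partial>lborel) * ?I k t \<partial>lborel)"
      by (simp add: nn_integral_cmult nn_integral_multc)
    also have "\<dots> = (\<integral>\<^sup>+t. ennreal (series_integrand n t) * ?I k t \<partial>lborel)"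
    proof (rule nn_integral_cong)
      fix t
      show "(\<integral>\<^sup>+x. ennreal (?B t x) \<partial>lborel) * (\<integral>\<^sup>+y. ennreal (?B t y) \<partial>lborel) * ?I k t
          = ennreal (series_integrand n t) * ?I k t"
      \<comment> \<open>The Beta formula needs \<open>t > 0\<close>; below the tail the indicator
        makes both sides 0.\<close>
      proof (cases "t \<ge> real (n + 1 + k)")
        case True
        then have "t > 0" by simp
        moreover from this have "0 \<le> fact n / (\<Prod>j=0..n. t + real j)"
          by (intro divide_nonneg_nonneg prod_nonneg) auto
        ultimately show ?thesis using assms
          by (simp add: nn_integral_beta_kernel series_integrand_def power2_eq_square flip: ennreal_mult)
      qed simp
    qed
    finally show "(\<integral>\<^sup>+x. \<integral>\<^sup>+y. \<integral>\<^sup>+t. ennreal (?B t x) * ennreal (?B t y) * ?I k t \<partial>lborel \<partial>lborel \<partial>lborel)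
      = (\<integral>\<^sup>+t. ennreal (series_integrand n t) * ?I k t \<partial>lborel)" .
  qed
  finally show ?thesis .
qed

text \<open>Nonnegativity and the cubic bound turn the \<open>ennreal\<close> tails into genuine
  Lebesgue integrals.\<close>

lemma series_integrand_tail:
  assumes "n > 0" "a \<ge> (1::real)"
  shows "set_integrable lborel {a..} (series_integrand n)"
    and "(\<integral>\<^sup>+t. ennreal (series_integrand n t) * indicator {a..} t \<partial>lborel)
      = ennreal (LINT t:{a..}|lborel. series_integrand n t)"
    and "(LINT t:{a..}|lborel. series_integrand n t) \<le> (fact n)\<^sup>2 / (3 * a ^ 3)"
proof -
  have eq: "(\<integral>\<^sup>+t. ennreal (series_integrand n t) * indicator {a..} t \<partial>lborel)
      = (\<integral>\<^sup>+t. ennreal (indicator {a..} t *\<^sub>R series_integrand n t) \<partial>lborel)"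
    by (intro nn_integral_cong) (auto simp: indicator_def)
  note bound = nn_integral_series_integrand_le[OF assms]
  show int: "set_integrable lborel {a..} (series_integrand n)"
    unfolding set_integrable_def
  proof (rule integrableI_nonneg)
    show "(\<integral>\<^sup>+t. ennreal (indicator {a..} t *\<^sub>R series_integrand n t) \<partial>lborel) < \<infinity>"
      using bound eq by (auto simp: top_unique less_top[symmetric])
  qed (auto simp: series_integrand_nonneg)
  then show nn: "(\<integral>\<^sup>+t. ennreal (series_integrand n t) * indicator {a..} t \<partial>lborel)
      = ennreal (LINT t:{a..}|lborel. series_integrand n t)"
    unfolding eq set_integrable_def set_lebesgue_integral_def
    by (intro nn_integral_eq_integral) (auto simp: series_integrand_nonneg)
  show "(LINT t:{a..}|lborel. series_integrand n t) \<le> (fact n)\<^sup>2 / (3 * a ^ 3)"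
    using bound assms unfolding nn by (subst (asm) ennreal_le_iff) auto
qed

theorem lemma3:
  fixes n :: nat
  assumes "n > 0"
  shows "(\<forall>\<nu>::nat. \<nu> \<ge> n + 1 \<longrightarrow> set_integrable lborel {real \<nu>..} (series_integrand n)) \<and>
    summable (\<lambda>k. LINT t:{real (n + 1 + k)..}|lborel. series_integrand n t) \<and>
    set_integrable lborel ({0..1} \<times> {0..1}) (\<lambda>(x, y). square_integrand n x y) \<and>
    (\<Sum>k. LINT t:{real (n + 1 + k)..}|lborel. series_integrand n t)
      = (LINT (x, y):{0..1} \<times> {0..1}|lborel. square_integrand n x y)"
proof -
  define a where "a k = (LINT t:{real (n + 1 + k)..}|lborel. series_integrand n t)" for k
  define f where "f p = indicator ({0..1} \<times> {0..1}) p *\<^sub>R (case p of (x, y) \<Rightarrow> square_integrand n x y)" for p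
  have a_nonneg: "a k \<ge> 0" for k
    unfolding a_def set_lebesgue_integral_def
    by (intro integral_nonneg_AE) (auto simp: series_integrand_nonneg)
  \<comment> \<open>The bound is put in the shape of a shifted series of reciprocal cubes, for the
    comparison test.\<close>
  have a_le: "a k \<le> (fact n)\<^sup>2 / 3 * inverse (real (k + (n + 1)) ^ 3)" for k
    using series_integrand_tail(3)[of n "real (n + 1 + k)"] assms
    by (simp add: a_def field_simps)
  have "summable (\<lambda>k. (fact n)\<^sup>2 / 3 * inverse (real (k + (n + 1)) ^ 3))"
    by (intro summable_mult summable_ignore_initial_segment inverse_power_summable) auto
  then have summable: "summable a"
    by (rule summable_comparison_test'[where N = 0]) (use a_nonneg a_le in auto)
  have [measurable]: "f \<in> borel_measurable lborel"
    unfolding f_def lborel_prod[symmetric] case_prod_unfold by measurable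
  have f_nonneg: "f p \<ge> 0" for p
    by (auto simp: f_def indicator_def square_integrand_nonneg split: prod.split)
  have "(\<integral>\<^sup>+p. ennreal (f p) \<partial>lborel) = (\<Sum>k. ennreal (a k))"
    unfolding f_def nn_integral_square_integrand[OF assms] a_def
    by (intro suminf_cong series_integrand_tail(2)) (use assms in auto)
  also have "\<dots> = ennreal (suminf a)"
    by (rule suminf_ennreal2[OF a_nonneg summable])
  \<comment> \<open>For nonnegative \<open>f\<close>, a finite value of the \<open>ennreal\<close>
    integral gives integrability on the square and the value of the integral at once; finiteness
    comes from the summability of \<open>a\<close>.\<close>
  finally have "integrable lborel f \<and> integral\<^sup>L lborel f = suminf a"
    by (subst (asm) nn_integral_eq_integrable) (auto simp: f_nonneg suminf_nonneg summable a_nonneg)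
  then show ?thesis
    using series_integrand_tail(1)[OF assms] summable
    unfolding a_def f_def set_integrable_def set_lebesgue_integral_def
    by (auto simp: case_prod_unfold)
qed

end
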